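(* Let $\sigma$ be a spectral function. Then $\|\cdot\|_\sigma=\rho_\sigma(|\cdot|)$ is a norm on $L_\sigma$.
   Context: Let $(\Omega,\mathcal{F},P)$ be a probability space and $L^0$ the space of real-valued random variables, identified when almost surely equal. A spectral function is a nondecreasing function $\sigma:[0,1)\to[0,\infty)$ with $\int_0^1\sigma(u)\,du=1$. For a random variable $Y$ and $0<u<1$ let $F_Y^{-1}(u):=\inf\{y:P(Y\le y)\ge u\}$, and let $\rho_\sigma(Y):=\int_0^1\sigma(u)F_Y^{-1}(u)\,du$ when the integral exists. Put $\|Y\|_\sigma:=\rho_\sigma(|Y|)\in[0,\infty]$ for $Y\in L^0$ and $L_\sigma:=\{Y\in L^0:\|Y\|_\sigma<\infty\}$. *)

theory Defs
  imports "HOL-Probability.Probability" "HOL-Algebra.Algebraic_Closure_Type"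
begin

(* Functions on [0,1) or (0,1) are total functions on the reals; only their values on
   that interval are ever used. *)

definition spectral_function :: "(real \<Rightarrow> real) \<Rightarrow> bool" where
  "spectral_function \<sigma> \<longleftrightarrow>
     mono_on {0..<1} \<sigma> \<and> (\<forall>u\<in>{0..<1}. 0 \<le> \<sigma> u) \<and> (LBINT u:{0..<1}. \<sigma> u) = 1"

definition quantile :: "'a measure \<Rightarrow> ('a \<Rightarrow> real) \<Rightarrow> real \<Rightarrow> real" where
  "quantile M Y u = Inf {y. \<P>(\<omega> in M. Y \<omega> \<le> y) \<ge> u}"

(* The integral in the extended sense: integral of the positive part minus integral of the
   negative part. It is meaningful unless both are infinite. *)
definition spectral_risk :: "'a measure \<Rightarrow> (real \<Rightarrow> real) \<Rightarrow> ('a \<Rightarrow> real) \<Rightarrow> ereal" where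
  "spectral_risk M \<sigma> Y =
     enn2ereal (\<integral>\<^sup>+u\<in>{0<..<1}. ennreal (\<sigma> u * quantile M Y u) \<partial>lborel)
   - enn2ereal (\<integral>\<^sup>+u\<in>{0<..<1}. ennreal (- (\<sigma> u * quantile M Y u)) \<partial>lborel)"

definition ae_eq :: "'a measure \<Rightarrow> (('a \<Rightarrow> real) \<times> ('a \<Rightarrow> real)) set" where
  "ae_eq M = {(f, g). f \<in> borel_measurable M \<and> g \<in> borel_measurable M \<and> (AE \<omega> in M. f \<omega> = g \<omega>)}"

(* The real vector space of random variables modulo almost sure equality. The record type
   module extends ring, but the locale module does not use its multiplicative fields. *)
definition L0 :: "'a measure \<Rightarrow> (real, ('a \<Rightarrow> real) set) module" where
  "L0 M =
    \<lparr>carrier = borel_measurable M // ae_eq M,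
     mult = undefined,
     one = undefined,
     zero = ae_eq M `` {\<lambda>\<omega>. 0},
     add = (\<lambda>A B. \<Union>f\<in>A. \<Union>g\<in>B. ae_eq M `` {\<lambda>\<omega>. f \<omega> + g \<omega>}),
     smult = (\<lambda>a A. \<Union>f\<in>A. ae_eq M `` {\<lambda>\<omega>. a * f \<omega>})\<rparr>"

(* The common value of the spectral risk of |Y| over the representatives Y of the class A;
   see spectral_norm_class below. *)
definition spectral_norm :: "'a measure \<Rightarrow> (real \<Rightarrow> real) \<Rightarrow> ('a \<Rightarrow> real) set \<Rightarrow> ereal" where
  "spectral_norm M \<sigma> A = the_elem ((\<lambda>Y. spectral_risk M \<sigma> (\<lambda>\<omega>. \<bar>Y \<omega>\<bar>)) ` A)"

definition L_spectral :: "'a measure \<Rightarrow> (real \<Rightarrow> real) \<Rightarrow> (real, ('a \<Rightarrow> real) set) module" where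
  "L_spectral M \<sigma> = (L0 M)\<lparr>carrier := {A \<in> carrier (L0 M). spectral_norm M \<sigma> A < \<infinity>}\<rparr>"

definition is_norm_on :: "(real, 'b) module \<Rightarrow> ('b \<Rightarrow> real) \<Rightarrow> bool" where
  "is_norm_on V N \<longleftrightarrow>
     module (ring_of_type_algebra :: real ring) V \<and>
     (\<forall>x\<in>carrier V. 0 \<le> N x) \<and>
     (\<forall>x\<in>carrier V. N x = 0 \<longleftrightarrow> x = \<zero>\<^bsub>V\<^esub>) \<and>
     (\<forall>a. \<forall>x\<in>carrier V. N (a \<odot>\<^bsub>V\<^esub> x) = \<bar>a\<bar> * N x) \<and>
     (\<forall>x\<in>carrier V. \<forall>y\<in>carrier V. N (x \<oplus>\<^bsub>V\<^esub> y) \<le> N x + N y)"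

lemma equiv_ae_eq: "equiv (borel_measurable M) (ae_eq M)"
proof (rule equivI)
  show "ae_eq M \<subseteq> borel_measurable M \<times> borel_measurable M"
    by (auto simp: ae_eq_def)
  show "refl_on (borel_measurable M) (ae_eq M)"
    by (auto simp: refl_on_def ae_eq_def)
  show "sym (ae_eq M)"
    by (auto simp: sym_def ae_eq_def elim: eventually_mono)
  show "trans (ae_eq M)"
  proof (rule transI)
    fix f g h assume "(f, g) \<in> ae_eq M" "(g, h) \<in> ae_eq M"
    then have fg: "AE \<omega> in M. f \<omega> = g \<omega>" and gh: "AE \<omega> in M. g \<omega> = h \<omega>"
      and m: "f \<in> borel_measurable M" "h \<in> borel_measurable M"
      by (auto simp: ae_eq_def)
    from fg gh have "AE \<omega> in M. f \<omega> = h \<omega>" by eventually_elim simp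
    with m show "(f, h) \<in> ae_eq M" by (auto simp: ae_eq_def)
  qed
qed

lemma add_L0_class:
  assumes "f \<in> borel_measurable M" "g \<in> borel_measurable M"
  shows "(ae_eq M `` {f}) \<oplus>\<^bsub>L0 M\<^esub> (ae_eq M `` {g}) = ae_eq M `` {\<lambda>\<omega>. f \<omega> + g \<omega>}"
proof -
  have "congruent2 (ae_eq M) (ae_eq M) (\<lambda>f g. ae_eq M `` {\<lambda>\<omega>. f \<omega> + g \<omega>})"
  proof (rule congruent2I')
    fix f f' g g' assume *: "(f, f') \<in> ae_eq M" "(g, g') \<in> ae_eq M"
    then have "AE \<omega> in M. f \<omega> = f' \<omega>" "AE \<omega> in M. g \<omega> = g' \<omega>" by (auto simp: ae_eq_def)
    then have "AE \<omega> in M. f \<omega> + g \<omega> = f' \<omega> + g' \<omega>" by eventually_elim simp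
    with * have "(\<lambda>\<omega>. f \<omega> + g \<omega>, \<lambda>\<omega>. f' \<omega> + g' \<omega>) \<in> ae_eq M" by (auto simp: ae_eq_def)
    then show "ae_eq M `` {\<lambda>\<omega>. f \<omega> + g \<omega>} = ae_eq M `` {\<lambda>\<omega>. f' \<omega> + g' \<omega>}"
      by (rule equiv_class_eq[OF equiv_ae_eq])
  qed
  from UN_equiv_class2[OF equiv_ae_eq equiv_ae_eq this assms] show ?thesis
    by (simp add: L0_def)
qed

lemma smult_L0_class:
  assumes "f \<in> borel_measurable M"
  shows "a \<odot>\<^bsub>L0 M\<^esub> (ae_eq M `` {f}) = ae_eq M `` {\<lambda>\<omega>. a * f \<omega>}"
proof -
  have "congruent (ae_eq M) (\<lambda>f. ae_eq M `` {\<lambda>\<omega>. a * f \<omega>})"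
  proof (rule congruentI)
    fix f f' assume *: "(f, f') \<in> ae_eq M"
    then have "AE \<omega> in M. f \<omega> = f' \<omega>" by (auto simp: ae_eq_def)
    then have "AE \<omega> in M. a * f \<omega> = a * f' \<omega>" by eventually_elim simp
    with * have "(\<lambda>\<omega>. a * f \<omega>, \<lambda>\<omega>. a * f' \<omega>) \<in> ae_eq M" by (auto simp: ae_eq_def)
    then show "ae_eq M `` {\<lambda>\<omega>. a * f \<omega>} = ae_eq M `` {\<lambda>\<omega>. a * f' \<omega>}"
      by (rule equiv_class_eq[OF equiv_ae_eq])
  qed
  from UN_equiv_class[OF equiv_ae_eq this assms] show ?thesis
    by (simp add: L0_def)
qed

lemma spectral_risk_cong_AE:
  assumes [measurable]: "f \<in> borel_measurable M" "g \<in> borel_measurable M"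
    and "AE \<omega> in M. f \<omega> = g \<omega>"
  shows "spectral_risk M \<sigma> f = spectral_risk M \<sigma> g"
proof -
  have "\<P>(\<omega> in M. f \<omega> \<le> y) = \<P>(\<omega> in M. g \<omega> \<le> y)" for y
  proof (rule measure_eq_AE)
    show "AE \<omega> in M. (\<omega> \<in> {\<omega> \<in> space M. f \<omega> \<le> y}) = (\<omega> \<in> {\<omega> \<in> space M. g \<omega> \<le> y})"
      using assms(3) by eventually_elim simp
  qed measurable
  then show ?thesis by (simp add: spectral_risk_def quantile_def)
qed

lemma spectral_norm_class:
  assumes f: "f \<in> borel_measurable M"
  shows "spectral_norm M \<sigma> (ae_eq M `` {f}) = spectral_risk M \<sigma> (\<lambda>\<omega>. \<bar>f \<omega>\<bar>)"
proof -
  have eq: "spectral_risk M \<sigma> (\<lambda>\<omega>. \<bar>g \<omega>\<bar>) = spectral_risk M \<sigma> (\<lambda>\<omega>. \<bar>f \<omega>\<bar>)"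
    if "g \<in> ae_eq M `` {f}" for g
  proof (rule spectral_risk_cong_AE)
    from that show "(\<lambda>\<omega>. \<bar>g \<omega>\<bar>) \<in> borel_measurable M" "(\<lambda>\<omega>. \<bar>f \<omega>\<bar>) \<in> borel_measurable M"
      by (auto simp: ae_eq_def)
    from that have "AE \<omega> in M. f \<omega> = g \<omega>" by (auto simp: ae_eq_def)
    then show "AE \<omega> in M. \<bar>g \<omega>\<bar> = \<bar>f \<omega>\<bar>" by eventually_elim simp
  qed
  have "f \<in> ae_eq M `` {f}" using f by (auto simp: ae_eq_def)
  with eq have "(\<lambda>Y. spectral_risk M \<sigma> (\<lambda>\<omega>. \<bar>Y \<omega>\<bar>)) ` (ae_eq M `` {f})
      = {spectral_risk M \<sigma> (\<lambda>\<omega>. \<bar>f \<omega>\<bar>)}"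
    by (metis (no_types, lifting) empty_iff image_cong image_constant_conv)
  then show ?thesis by (simp add: spectral_norm_def)
qed

(* The norm takes values in [0, infinity], so real_of_ereal loses nothing on L_spectral. *)
lemma spectral_norm_nonneg:
  assumes "prob_space M" "spectral_function \<sigma>" "A \<in> carrier (L0 M)"
  shows "0 \<le> spectral_norm M \<sigma> A"
proof -
  interpret prob_space M by fact
  from assms(3) obtain f where [measurable]: "f \<in> borel_measurable M" and A: "A = ae_eq M `` {f}"
    by (auto simp: L0_def elim: quotientE)
  have q: "0 \<le> quantile M (\<lambda>\<omega>. \<bar>f \<omega>\<bar>) u" if u: "0 < u" "u < 1" for u
    unfolding quantile_def
  proof (rule cInf_greatest)
    interpret D: real_distribution "distr M borel (\<lambda>\<omega>. \<bar>f \<omega>\<bar>)"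
      by (rule real_distribution_distr) measurable
    have "\<forall>\<^sub>F y in at_top. u < cdf (distr M borel (\<lambda>\<omega>. \<bar>f \<omega>\<bar>)) y"
      using D.cdf_lim_at_top_prob u(2) by (rule order_tendstoD)
    then obtain y where "u < cdf (distr M borel (\<lambda>\<omega>. \<bar>f \<omega>\<bar>)) y"
      by (auto dest: eventually_happens)
    then have "u \<le> \<P>(\<omega> in M. \<bar>f \<omega>\<bar> \<le> y)"
      by (simp add: cdf_def measure_distr vimage_def Int_def conj_commute)
    then show "{y. u \<le> \<P>(\<omega> in M. \<bar>f \<omega>\<bar> \<le> y)} \<noteq> {}" by blast
  next
    fix y assume *: "y \<in> {y. u \<le> \<P>(\<omega> in M. \<bar>f \<omega>\<bar> \<le> y)}"
    show "0 \<le> y"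
    proof (rule ccontr)
      assume "\<not> 0 \<le> y"
      then have "{\<omega> \<in> space M. \<bar>f \<omega>\<bar> \<le> y} = {}" by auto
      then have "\<P>(\<omega> in M. \<bar>f \<omega>\<bar> \<le> y) = 0" by (simp only: measure_empty)
      with * u show False by simp
    qed
  qed
  have "ennreal (- (\<sigma> u * quantile M (\<lambda>\<omega>. \<bar>f \<omega>\<bar>) u)) * indicator {0<..<1} u = 0" for u
    using q[of u] assms(2) by (auto simp: spectral_function_def indicator_def ennreal_neg)
  then have "(\<integral>\<^sup>+u\<in>{0<..<1}. ennreal (- (\<sigma> u * quantile M (\<lambda>\<omega>. \<bar>f \<omega>\<bar>) u)) \<partial>lborel) = 0"
    by (simp only: nn_integral_const) simp
  then have "spectral_risk M \<sigma> (\<lambda>\<omega>. \<bar>f \<omega>\<bar>)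
      = enn2ereal (\<integral>\<^sup>+u\<in>{0<..<1}. ennreal (\<sigma> u * quantile M (\<lambda>\<omega>. \<bar>f \<omega>\<bar>) u) \<partial>lborel)"
    by (simp add: spectral_risk_def zero_ennreal.rep_eq)
  then show ?thesis by (simp add: A spectral_norm_class)
qed

end

theory Submission
  imports Defs
begin

text \<open>
  Only the triangle inequality is substantial. The quantile function is not subadditive pointwise, but
  its upper tail integrals are. For a nonnegative random variable \<open>Y\<close> with quantile
  function \<open>q\<close> and a nonempty upper segment \<open>A\<close> of the open unit interval, the
  integral of \<open>q\<close> over \<open>A\<close> is the minimum over \<open>x \<ge> 0\<close> of
  \<open>x * \<bar>A\<bar> + E (Y - x)\<^sup>+\<close>, where \<open>\<bar>A\<bar>\<close> is the length
  of \<open>A\<close> (the Rockafellar--Uryasev formula for expected shortfall). The inequality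
  \<open>\<le>\<close> holds because \<open>q \<le> x + (q - x)\<^sup>+\<close> pointwise and because
  \<open>q\<close> has, under the uniform distribution, the law of \<open>Y\<close>
  (\<open>tail_integral_le\<close>). Equality holds at the infimum \<open>x\<close> of \<open>q\<close>
  over \<open>A\<close>, which separates its values on \<open>A\<close> from those off \<open>A\<close>
  (\<open>tail_integral_attained\<close>). Adding the minimisers for \<open>Y\<close> and
  \<open>Z\<close> gives a competitor for every \<open>W \<le> Y + Z\<close>, so tail integrals are
  monotone and subadditive (\<open>tail_integral_subadditive\<close>). This works on every probability
  space, atoms included.

  Since \<open>\<sigma>\<close> is nonnegative and nondecreasing on the unit interval, it is the
  integral over \<open>t \<ge> 0\<close> of the indicators of the upper segments \<open>{u. t < \<sigma>
  u}\<close>; by Tonelli, the integral of \<open>\<sigma>\<close> against a quantile function is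
  therefore a mixture of tail integrals and inherits subadditivity from them
  (\<open>spectral_integral_subadditive\<close>).

  For definiteness, a spectral function cannot vanish on the whole of \<open>(0,1)\<close>, hence it is
  positive near \<open>1\<close>. If the norm of \<open>Y\<close> is \<open>0\<close>, the quantile
  function of \<open>\<bar>Y\<bar>\<close> vanishes almost everywhere near \<open>1\<close>, hence
  everywhere by monotonicity, and \<open>E \<bar>Y\<bar> = 0\<close>. Homogeneity is that of quantiles.
  The triangle inequality and homogeneity show that the classes of finite norm form a submodule of
  \<open>L0 M\<close>, so that \<open>L_spectral M \<sigma>\<close> is a vector space.
\<close>

section \<open>Quantile functions\<close>

abbreviation unit_interval :: "real measure" where
  "unit_interval \<equiv> restrict_space lborel {0<..<1}"

lemma (in prob_space) cdf_distr_eq_prob_le: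
  assumes [measurable]: "Y \<in> borel_measurable M"
  shows "cdf (distr M borel Y) y = \<P>(\<omega> in M. Y \<omega> \<le> y)"
  by (simp add: cdf_def measure_distr vimage_def Int_def conj_commute)

lemma (in prob_space) quantile_eq_Inf_cdf:
  assumes "Y \<in> borel_measurable M"
  shows "quantile M Y u = Inf {y. u \<le> cdf (distr M borel Y) y}"
  using cdf_distr_eq_prob_le[OF assms] by (simp add: quantile_def)

lemma (in prob_space) cdf_distribution_distr:
  "Y \<in> borel_measurable M \<Longrightarrow> cdf_distribution (distr M borel Y)"
  by (simp add: cdf_distribution_def)

text \<open>
  Quantiles are the left adjoint of the distribution function. Comparing a quantile
  with every \<open>y\<close> in this way replaces computations with the infimum that defines it.
\<close>
lemma (in prob_space) quantile_le_iff:
  assumes Y: "Y \<in> borel_measurable M" and u: "0 < u" "u < 1"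
  shows "quantile M Y u \<le> y \<longleftrightarrow> u \<le> \<P>(\<omega> in M. Y \<omega> \<le> y)"
proof -
  interpret D: cdf_distribution "distr M borel Y"
    by (rule cdf_distribution_distr[OF Y])
  show ?thesis
    using D.pseudoinverse[of u y] u
    by (simp add: quantile_eq_Inf_cdf[OF Y] cdf_distr_eq_prob_le[OF Y])
qed

lemma (in prob_space) quantile_mono_on:
  assumes Y: "Y \<in> borel_measurable M"
  shows "mono_on {0<..<1} (quantile M Y)"
proof -
  interpret D: cdf_distribution "distr M borel Y"
    by (rule cdf_distribution_distr[OF Y])
  show ?thesis
    using D.mono_I by (simp add: quantile_eq_Inf_cdf[OF Y] mono_on_def)
qed

lemma measurable_unit_interval_mono_on:
  fixes f :: "real \<Rightarrow> real"
  assumes "mono_on {0<..<1} f"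
  shows "f \<in> borel_measurable unit_interval"
proof -
  have "sets unit_interval = sets (restrict_space borel {0<..<1})"
    by (intro sets_restrict_space_cong) simp
  then show ?thesis
    using borel_measurable_mono_on_fnc[OF assms] measurable_cong_sets by blast
qed

lemma (in prob_space) measurable_quantile:
  "Y \<in> borel_measurable M \<Longrightarrow> quantile M Y \<in> borel_measurable unit_interval"
  by (intro measurable_unit_interval_mono_on quantile_mono_on)

text \<open>
  Inverse transform sampling: the quantile function of a uniform variable has the
  distribution of \<open>Y\<close>.
\<close>
lemma (in prob_space) nn_integral_quantile:
  assumes Y[measurable]: "Y \<in> borel_measurable M" and h[measurable]: "h \<in> borel_measurable borel"
  shows "(\<integral>\<^sup>+u. h (quantile M Y u) \<partial>unit_interval) = (\<integral>\<^sup>+\<omega>. h (Y \<omega>) \<partial>M)"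
proof -
  interpret D: cdf_distribution "distr M borel Y"
    by (rule cdf_distribution_distr[OF Y])
  have distr_eq: "distr unit_interval borel (quantile M Y) = distr M borel Y"
    using D.distr_I_eq_M by (simp add: quantile_eq_Inf_cdf[OF Y, abs_def])
  have "(\<integral>\<^sup>+u. h (quantile M Y u) \<partial>unit_interval)
      = (\<integral>\<^sup>+y. h y \<partial>distr unit_interval borel (quantile M Y))"
    by (rule nn_integral_distr[symmetric]) (use measurable_quantile[OF Y] in simp_all)
  also have "\<dots> = (\<integral>\<^sup>+\<omega>. h (Y \<omega>) \<partial>M)"
    unfolding distr_eq by (rule nn_integral_distr) measurable
  finally show ?thesis .
qed

lemma (in prob_space) quantile_nonneg:
  assumes Y: "Y \<in> borel_measurable M" and nonneg: "\<And>\<omega>. 0 \<le> Y \<omega>" and u: "0 < u" "u < 1"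
  shows "0 \<le> quantile M Y u"
proof -
  have "{\<omega> \<in> space M. Y \<omega> \<le> quantile M Y u} \<noteq> {}"
    using quantile_le_iff[OF Y u, of "quantile M Y u"] u(1)
    by (metis less_le_not_le measure_empty order_refl)
  then show ?thesis
    using nonneg order_trans by blast
qed

lemma (in prob_space) quantile_cmult:
  assumes Y[measurable]: "Y \<in> borel_measurable M" and c: "0 \<le> c" and u: "0 < u" "u < 1"
  shows "quantile M (\<lambda>\<omega>. c * Y \<omega>) u = c * quantile M Y u"
proof -
  have "quantile M (\<lambda>\<omega>. c * Y \<omega>) u \<le> y \<longleftrightarrow> c * quantile M Y u \<le> y" for y
  proof (cases "c = 0")
    case True
    then show ?thesis
      using u by (cases "0 \<le> y") (auto simp: quantile_le_iff prob_space)
  next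
    case False
    then have "c * z \<le> y \<longleftrightarrow> z \<le> y / c" for z
      using c by (simp add: field_simps)
    then show ?thesis
      using u by (simp add: quantile_le_iff)
  qed
  then show ?thesis
    by (meson antisym order_refl)
qed

section \<open>Tail integrals of the quantile function\<close>

text \<open>
  Here, and below, \<open>ennreal (Y \<omega> - x)\<close> stands for the positive part \<open>(Y \<omega> - x)\<^sup>+\<close>,
  because \<open>ennreal\<close> sends negative numbers to \<open>0\<close>. The inequality is
  \<open>q \<le> x + (q - x)\<^sup>+\<close>, integrated over \<open>A\<close>, with the last summand enlarged to the whole
  unit interval.
\<close>
lemma (in prob_space) tail_integral_le:
  assumes Y[measurable]: "Y \<in> borel_measurable M" and x: "0 \<le> x"
    and A[measurable]: "A \<in> sets unit_interval"
  shows "(\<integral>\<^sup>+u\<in>A. ennreal (quantile M Y u) \<partial>unit_interval)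
    \<le> ennreal x * emeasure unit_interval A + (\<integral>\<^sup>+\<omega>. ennreal (Y \<omega> - x) \<partial>M)"
proof -
  note [measurable] = measurable_quantile[OF Y]
  have "(\<integral>\<^sup>+u\<in>A. ennreal (quantile M Y u) \<partial>unit_interval)
      \<le> (\<integral>\<^sup>+u. ennreal x * indicator A u + ennreal (quantile M Y u - x) \<partial>unit_interval)"
    using x by (intro nn_integral_mono)
      (auto simp: indicator_def ennreal_plus_if ennreal_leI split: if_splits)
  also have "\<dots> = ennreal x * emeasure unit_interval A
      + (\<integral>\<^sup>+u. ennreal (quantile M Y u - x) \<partial>unit_interval)"
    by (simp add: nn_integral_add nn_integral_cmult_indicator)
  finally show ?thesis
    using nn_integral_quantile[OF Y, of "\<lambda>z. ennreal (z - x)"] by simp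
qed

text \<open>
  Both losses in the preceding estimate vanish at the infimum \<open>x\<close> of the quantile function
  \<open>q\<close> over \<open>A\<close>: on \<open>A\<close> we have \<open>q = x + (q - x)\<^sup>+\<close> since \<open>x \<le> q\<close>, and off \<open>A\<close> we have
  \<open>(q - x)\<^sup>+ = 0\<close>, since there \<open>q\<close> is below all its values on \<open>A\<close>.
\<close>
lemma (in prob_space) tail_integral_attained:
  assumes Y[measurable]: "Y \<in> borel_measurable M" and nonneg: "\<And>\<omega>. 0 \<le> Y \<omega>"
    and A[measurable]: "A \<in> sets unit_interval" and ne: "A \<noteq> {}"
    and up: "\<forall>u\<in>A. {u..<1} \<subseteq> A"
  obtains x where "0 \<le> x"
    "(\<integral>\<^sup>+u\<in>A. ennreal (quantile M Y u) \<partial>unit_interval)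
      = ennreal x * emeasure unit_interval A + (\<integral>\<^sup>+\<omega>. ennreal (Y \<omega> - x) \<partial>M)"
proof
  let ?q = "quantile M Y" and ?x = "INF u\<in>A. quantile M Y u"
  note [measurable] = measurable_quantile[OF Y]
  have A_sub: "A \<subseteq> {0<..<1}"
    using sets.sets_into_space[OF A] by (simp add: space_restrict_space)
  have q_nonneg: "0 \<le> ?q u" if "u \<in> A" for u
    using A_sub that by (auto intro!: quantile_nonneg[OF Y nonneg])
  show x: "0 \<le> ?x"
    using ne q_nonneg by (intro cINF_greatest)
  have in_A: "?x \<le> ?q u" if "u \<in> A" for u
    using that q_nonneg by (intro cINF_lower bdd_belowI2[where m=0])
  have off_A: "?q v \<le> ?x" if v: "v \<in> {0<..<1}" "v \<notin> A" for v
  proof (rule cINF_greatest[OF ne])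
    fix u assume u: "u \<in> A"
    have "v \<notin> {u..<1}"
      using up u v by blast
    then have "v \<le> u"
      using v by auto
    then show "?q v \<le> ?q u"
      using quantile_mono_on[OF Y] u v A_sub by (auto simp: mono_on_def)
  qed
  have "(\<integral>\<^sup>+u\<in>A. ennreal (?q u) \<partial>unit_interval)
      = (\<integral>\<^sup>+u. ennreal ?x * indicator A u + ennreal (?q u - ?x) \<partial>unit_interval)"
  proof (rule nn_integral_cong)
    fix u assume "u \<in> space unit_interval"
    then show "ennreal (?q u) * indicator A u = ennreal ?x * indicator A u + ennreal (?q u - ?x)"
      using in_A[of u] off_A[of u] x
      by (cases "u \<in> A") (simp_all add: space_restrict_space ennreal_neg flip: ennreal_plus)
  qed
  also have "\<dots> = ennreal ?x * emeasure unit_interval A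
      + (\<integral>\<^sup>+u. ennreal (?q u - ?x) \<partial>unit_interval)"
    by (simp add: nn_integral_add nn_integral_cmult_indicator)
  finally show "(\<integral>\<^sup>+u\<in>A. ennreal (?q u) \<partial>unit_interval)
      = ennreal ?x * emeasure unit_interval A + (\<integral>\<^sup>+\<omega>. ennreal (Y \<omega> - ?x) \<partial>M)"
    using nn_integral_quantile[OF Y, of "\<lambda>z. ennreal (z - ?x)"] by simp
qed

text \<open>
  If \<open>x\<close> and \<open>y\<close> are optimal for \<open>Y\<close> and \<open>Z\<close>, then \<open>x + y\<close> is admissible for \<open>W\<close>, and
  \<open>(W - (x + y))\<^sup>+ \<le> (Y - x)\<^sup>+ + (Z - y)\<^sup>+\<close>. Allowing \<open>W \<le> Y + Z\<close> instead of a sum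
  lets the lemma apply to \<open>\<bar>f + g\<bar> \<le> \<bar>f\<bar> + \<bar>g\<bar>\<close>.
\<close>
lemma (in prob_space) tail_integral_subadditive:
  assumes Y[measurable]: "Y \<in> borel_measurable M" and Y_nonneg: "\<And>\<omega>. 0 \<le> Y \<omega>"
    and Z[measurable]: "Z \<in> borel_measurable M" and Z_nonneg: "\<And>\<omega>. 0 \<le> Z \<omega>"
    and W[measurable]: "W \<in> borel_measurable M" and W_le: "\<And>\<omega>. W \<omega> \<le> Y \<omega> + Z \<omega>"
    and A: "A \<in> sets unit_interval"
    and up: "\<forall>u\<in>A. {u..<1} \<subseteq> A"
  shows "(\<integral>\<^sup>+u\<in>A. ennreal (quantile M W u) \<partial>unit_interval)
    \<le> (\<integral>\<^sup>+u\<in>A. ennreal (quantile M Y u) \<partial>unit_interval)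
      + (\<integral>\<^sup>+u\<in>A. ennreal (quantile M Z u) \<partial>unit_interval)"
proof (cases "A = {}")
  case False
  let ?m = "emeasure unit_interval A"
  obtain x where x: "0 \<le> x"
    and Y_eq: "(\<integral>\<^sup>+u\<in>A. ennreal (quantile M Y u) \<partial>unit_interval)
      = ennreal x * ?m + (\<integral>\<^sup>+\<omega>. ennreal (Y \<omega> - x) \<partial>M)"
    using tail_integral_attained[OF Y Y_nonneg A False up] by blast
  obtain y where y: "0 \<le> y"
    and Z_eq: "(\<integral>\<^sup>+u\<in>A. ennreal (quantile M Z u) \<partial>unit_interval)
      = ennreal y * ?m + (\<integral>\<^sup>+\<omega>. ennreal (Z \<omega> - y) \<partial>M)"
    using tail_integral_attained[OF Z Z_nonneg A False up] by blast
  have le: "ennreal (W \<omega> - (x + y)) \<le> ennreal (Y \<omega> - x) + ennreal (Z \<omega> - y)" for \<omega>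
    using W_le[of \<omega>] by (auto simp: ennreal_plus_if intro!: ennreal_leI)
  have "(\<integral>\<^sup>+u\<in>A. ennreal (quantile M W u) \<partial>unit_interval)
      \<le> ennreal (x + y) * ?m + (\<integral>\<^sup>+\<omega>. ennreal (W \<omega> - (x + y)) \<partial>M)"
    using x y by (intro tail_integral_le[OF W _ A]) simp
  also have "\<dots> \<le> ennreal (x + y) * ?m
      + (\<integral>\<^sup>+\<omega>. ennreal (Y \<omega> - x) + ennreal (Z \<omega> - y) \<partial>M)"
    by (intro add_left_mono nn_integral_mono le)
  also have "\<dots> = (\<integral>\<^sup>+u\<in>A. ennreal (quantile M Y u) \<partial>unit_interval)
      + (\<integral>\<^sup>+u\<in>A. ennreal (quantile M Z u) \<partial>unit_interval)"
    unfolding Y_eq Z_eq using x y by (simp add: nn_integral_add distrib_right ac_simps)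
  finally show ?thesis .
qed simp

section \<open>The spectral integral\<close>

text \<open>
  The spectral risk of a nonnegative random variable, with values in \<open>[0,\<infinity>]\<close> so that
  Tonelli applies without integrability conditions.
\<close>
definition spectral_integral :: "'a measure \<Rightarrow> (real \<Rightarrow> real) \<Rightarrow> ('a \<Rightarrow> real) \<Rightarrow> ennreal" where
  "spectral_integral M \<sigma> Y = (\<integral>\<^sup>+u. ennreal (\<sigma> u) * ennreal (quantile M Y u) \<partial>unit_interval)"

lemma spectral_function_mono_on:
  "spectral_function \<sigma> \<Longrightarrow> mono_on {0<..<1} \<sigma>"
  by (auto simp: spectral_function_def mono_on_def)

lemma measurable_spectral_function:
  "spectral_function \<sigma> \<Longrightarrow> \<sigma> \<in> borel_measurable unit_interval"
  by (intro measurable_unit_interval_mono_on spectral_function_mono_on)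

text \<open>
  Tonelli, applied to \<open>\<sigma>\<^sup>+(u) = \<integral> 1[0 \<le> t < \<sigma>(u)] dt\<close>. For nondecreasing \<open>\<sigma>\<close> the inner
  integrals on the right are tail integrals.
\<close>
lemma nn_integral_layer_cake:
  fixes \<sigma> :: "real \<Rightarrow> real"
  assumes [measurable]: "\<sigma> \<in> borel_measurable unit_interval" "g \<in> borel_measurable unit_interval"
  shows "(\<integral>\<^sup>+u. ennreal (\<sigma> u) * g u \<partial>unit_interval)
    = (\<integral>\<^sup>+t. indicator {0..} t
        * (\<integral>\<^sup>+u\<in>{u \<in> space unit_interval. t < \<sigma> u}. g u \<partial>unit_interval) \<partial>lborel)"
proof -
  interpret U: sigma_finite_measure unit_interval
    by (intro sigma_finite_measure_restrict_space) (simp_all add: sigma_finite_lborel)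
  interpret pair_sigma_finite unit_interval lborel
    by (simp add: pair_sigma_finite_def U.sigma_finite_measure_axioms sigma_finite_lborel)
  let ?f = "\<lambda>u t. if 0 \<le> t \<and> t < \<sigma> u then g u else 0"
  have "(\<integral>\<^sup>+u. ennreal (\<sigma> u) * g u \<partial>unit_interval)
      = (\<integral>\<^sup>+u. (\<integral>\<^sup>+t. ?f u t \<partial>lborel) \<partial>unit_interval)"
  proof (rule nn_integral_cong)
    fix u
    have "(\<integral>\<^sup>+t. ?f u t \<partial>lborel) = (\<integral>\<^sup>+t. g u * indicator {0..<\<sigma> u} t \<partial>lborel)"
      by (intro nn_integral_cong) (auto simp: indicator_def)
    also have "\<dots> = ennreal (\<sigma> u) * g u"
      by (cases "0 \<le> \<sigma> u") (simp_all add: nn_integral_cmult_indicator ennreal_neg mult.commute)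
    finally show "ennreal (\<sigma> u) * g u = (\<integral>\<^sup>+t. ?f u t \<partial>lborel)" ..
  qed
  also have "\<dots> = (\<integral>\<^sup>+t. (\<integral>\<^sup>+u. ?f u t \<partial>unit_interval) \<partial>lborel)"
    by (intro Fubini'[symmetric]) measurable
  also have "\<dots> = (\<integral>\<^sup>+t. indicator {0..} t
      * (\<integral>\<^sup>+u\<in>{u \<in> space unit_interval. t < \<sigma> u}. g u \<partial>unit_interval) \<partial>lborel)"
    by (intro nn_integral_cong) (auto simp: indicator_def intro!: nn_integral_cong)
  finally show ?thesis .
qed

lemma (in prob_space) spectral_integral_subadditive:
  assumes \<sigma>: "spectral_function \<sigma>"
    and Y: "Y \<in> borel_measurable M" and Y_nonneg: "\<And>\<omega>. 0 \<le> Y \<omega>"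
    and Z: "Z \<in> borel_measurable M" and Z_nonneg: "\<And>\<omega>. 0 \<le> Z \<omega>"
    and W: "W \<in> borel_measurable M" and W_le: "\<And>\<omega>. W \<omega> \<le> Y \<omega> + Z \<omega>"
  shows "spectral_integral M \<sigma> W \<le> spectral_integral M \<sigma> Y + spectral_integral M \<sigma> Z"
proof -
  note [measurable] = measurable_spectral_function[OF \<sigma>]
    measurable_quantile[OF Y] measurable_quantile[OF Z] measurable_quantile[OF W]
  let ?A = "\<lambda>t. {u \<in> space unit_interval. t < \<sigma> u}"
  have tail: "(\<integral>\<^sup>+u\<in>?A t. ennreal (quantile M W u) \<partial>unit_interval)
      \<le> (\<integral>\<^sup>+u\<in>?A t. ennreal (quantile M Y u) + ennreal (quantile M Z u) \<partial>unit_interval)" for t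
  proof -
    have "v \<in> ?A t" if "u \<in> ?A t" "u \<le> v" "v < 1" for u v
      using that mono_onD[OF spectral_function_mono_on[OF \<sigma>], of u v]
      by (auto simp: space_restrict_space)
    then have up: "\<forall>u\<in>?A t. {u..<1} \<subseteq> ?A t"
      by auto
    have A[measurable]: "?A t \<in> sets unit_interval"
      by measurable
    have "(\<integral>\<^sup>+u\<in>?A t. ennreal (quantile M W u) \<partial>unit_interval)
        \<le> (\<integral>\<^sup>+u\<in>?A t. ennreal (quantile M Y u) \<partial>unit_interval)
          + (\<integral>\<^sup>+u\<in>?A t. ennreal (quantile M Z u) \<partial>unit_interval)"
      by (rule tail_integral_subadditive[OF Y Y_nonneg Z Z_nonneg W W_le A up])
    also have "\<dots> = (\<integral>\<^sup>+u\<in>?A t. ennreal (quantile M Y u) + ennreal (quantile M Z u) \<partial>unit_interval)"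
      unfolding distrib_right by (rule nn_integral_add[symmetric]) measurable
    finally show ?thesis .
  qed
  have "spectral_integral M \<sigma> W = (\<integral>\<^sup>+t. indicator {0..} t
      * (\<integral>\<^sup>+u\<in>?A t. ennreal (quantile M W u) \<partial>unit_interval) \<partial>lborel)"
    unfolding spectral_integral_def by (rule nn_integral_layer_cake) measurable
  also have "\<dots> \<le> (\<integral>\<^sup>+t. indicator {0..} t * (\<integral>\<^sup>+u\<in>?A t.
      ennreal (quantile M Y u) + ennreal (quantile M Z u) \<partial>unit_interval) \<partial>lborel)"
    by (rule nn_integral_mono) (rule mult_left_mono[OF tail zero_le])
  also have "\<dots> = (\<integral>\<^sup>+u. ennreal (\<sigma> u)
      * (ennreal (quantile M Y u) + ennreal (quantile M Z u)) \<partial>unit_interval)"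
    by (rule nn_integral_layer_cake[symmetric]) measurable
  also have "\<dots> = spectral_integral M \<sigma> Y + spectral_integral M \<sigma> Z"
    by (simp add: spectral_integral_def nn_integral_add distrib_left)
  finally show ?thesis .
qed

lemma (in prob_space) spectral_integral_cmult:
  assumes \<sigma>: "spectral_function \<sigma>" and Y: "Y \<in> borel_measurable M" and c: "0 \<le> c"
  shows "spectral_integral M \<sigma> (\<lambda>\<omega>. c * Y \<omega>) = ennreal c * spectral_integral M \<sigma> Y"
proof -
  note [measurable] = measurable_spectral_function[OF \<sigma>] measurable_quantile[OF Y]
  have "spectral_integral M \<sigma> (\<lambda>\<omega>. c * Y \<omega>)
      = (\<integral>\<^sup>+u. ennreal c * (ennreal (\<sigma> u) * ennreal (quantile M Y u)) \<partial>unit_interval)"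
    unfolding spectral_integral_def
    using c by (intro nn_integral_cong)
      (simp add: space_restrict_space quantile_cmult[OF Y] ennreal_mult' ac_simps)
  then show ?thesis
    by (simp add: nn_integral_cmult spectral_integral_def)
qed

text \<open>
  By monotonicity, a spectral function that vanishes on \<open>(0,1)\<close> also vanishes at \<open>0\<close>, which
  contradicts its integral being \<open>1\<close>.
\<close>
lemma spectral_function_pos_somewhere:
  assumes \<sigma>: "spectral_function \<sigma>"
  obtains u where "u \<in> {0<..<1}" "0 < \<sigma> u"
proof -
  have "\<exists>u\<in>{0<..<1}. 0 < \<sigma> u"
  proof (rule ccontr)
    assume no: "\<not> ?thesis"
    have "\<sigma> u = 0" if u: "u \<in> {0..<1}" for u
    proof -
      \<comment> \<open>The midpoint of \<open>u\<close> and \<open>1\<close> lies in the open interval even when \<open>u = 0\<close>.\<close>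
      have "\<sigma> u \<le> \<sigma> ((u + 1) / 2)"
        using \<sigma> u by (auto simp: spectral_function_def intro!: mono_onD[of "{0..<1}" \<sigma>])
      moreover have "\<sigma> ((u + 1) / 2) \<le> 0"
        using no u by (auto simp: not_less)
      moreover have "0 \<le> \<sigma> u"
        using \<sigma> u by (simp add: spectral_function_def)
      ultimately show ?thesis by simp
    qed
    then have "(LBINT u:{0..<1}. \<sigma> u) = (LBINT u:{0..<1::real}. (0::real))"
      by (intro set_lebesgue_integral_cong) auto
    then show False
      using \<sigma> by (simp add: spectral_function_def)
  qed
  then show thesis using that by blast
qed

text \<open>
  Let \<open>\<sigma> u0 > 0\<close>. A positive value of the quantile function at \<open>v\<close> would make both factors
  of the integrand positive on the whole interval from \<open>max u0 v\<close> to \<open>1\<close>. So the quantile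
  function is nowhere positive, and its integral, which is the expectation of \<open>Y\<close>, is \<open>0\<close>.
\<close>
lemma (in prob_space) spectral_integral_eq_0_imp_AE:
  assumes \<sigma>: "spectral_function \<sigma>"
    and Y[measurable]: "Y \<in> borel_measurable M" and nonneg: "\<And>\<omega>. 0 \<le> Y \<omega>"
    and zero: "spectral_integral M \<sigma> Y = 0"
  shows "AE \<omega> in M. Y \<omega> = 0"
proof -
  note [measurable] = measurable_spectral_function[OF \<sigma>] measurable_quantile[OF Y]
  obtain u0 where u0: "u0 \<in> {0<..<1}" "0 < \<sigma> u0"
    using spectral_function_pos_somewhere[OF \<sigma>] .
  have "AE u in unit_interval. ennreal (\<sigma> u) * ennreal (quantile M Y u) = 0"
    using zero by (simp add: spectral_integral_def nn_integral_0_iff_AE)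
  then have AE_q: "AE u in lborel. u \<in> {0<..<1} \<longrightarrow> \<sigma> u \<le> 0 \<or> quantile M Y u \<le> 0"
    by (simp add: AE_restrict_space_iff ennreal_eq_0_iff)
  have q0: "quantile M Y v \<le> 0" if v: "v \<in> {0<..<1}" for v
  proof (rule ccontr)
    assume pos: "\<not> quantile M Y v \<le> 0"
    have "\<not> (\<sigma> u \<le> 0 \<or> quantile M Y u \<le> 0)" if u: "max u0 v < u" "u < 1" for u
    proof -
      have "\<sigma> u0 \<le> \<sigma> u" "quantile M Y v \<le> quantile M Y u"
        using u u0 v spectral_function_mono_on[OF \<sigma>] quantile_mono_on[OF Y]
        by (auto simp: mono_on_def)
      then show ?thesis
        using u0 pos by simp
    qed
    with AE_q have "AE u in lborel. u \<notin> {max u0 v<..<1}"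
      using u0 by (auto elim!: eventually_mono)
    then have "emeasure lborel {max u0 v<..<1} = 0"
      by (subst AE_iff_measurable[symmetric, where P="\<lambda>u. u \<notin> {max u0 v<..<1}"]) auto
    then show False
      using u0 v by (simp add: max_def split: if_splits)
  qed
  have "(\<integral>\<^sup>+\<omega>. ennreal (Y \<omega>) \<partial>M) = (\<integral>\<^sup>+u. ennreal (quantile M Y u) \<partial>unit_interval)"
    using nn_integral_quantile[OF Y, of ennreal] by simp
  also have "\<dots> = (\<integral>\<^sup>+u. 0 \<partial>unit_interval)"
    using q0 by (intro nn_integral_cong) (simp add: space_restrict_space ennreal_neg)
  finally have "AE \<omega> in M. ennreal (Y \<omega>) = 0"
    by (simp add: nn_integral_0_iff_AE)
  then show ?thesis
    by eventually_elim (use nonneg in \<open>simp add: ennreal_eq_0_iff antisym\<close>)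
qed

section \<open>The vector space of random variables\<close>

lemma carrier_L0E:
  assumes "A \<in> carrier (L0 M)"
  obtains f where "f \<in> borel_measurable M" "A = ae_eq M `` {f}"
  using assms by (auto simp: L0_def elim: quotientE)

lemma class_in_carrier_L0: "f \<in> borel_measurable M \<Longrightarrow> ae_eq M `` {f} \<in> carrier (L0 M)"
  by (simp add: L0_def quotientI)

lemma zero_L0: "\<zero>\<^bsub>L0 M\<^esub> = ae_eq M `` {\<lambda>\<omega>. 0}"
  by (simp add: L0_def)

lemma class_eq_zero_iff:
  assumes "f \<in> borel_measurable M"
  shows "ae_eq M `` {f} = \<zero>\<^bsub>L0 M\<^esub> \<longleftrightarrow> (AE \<omega> in M. f \<omega> = 0)"
  using assms by (simp add: zero_L0 eq_equiv_class_iff[OF equiv_ae_eq]) (simp add: ae_eq_def)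

lemma abelian_group_L0: "abelian_group (L0 M)"
proof (rule abelian_groupI)
  fix A assume "A \<in> carrier (L0 M)"
  then obtain f where [measurable]: "f \<in> borel_measurable M" and A: "A = ae_eq M `` {f}"
    by (rule carrier_L0E)
  show "\<exists>B\<in>carrier (L0 M). B \<oplus>\<^bsub>L0 M\<^esub> A = \<zero>\<^bsub>L0 M\<^esub>"
    by (rule bexI[of _ "ae_eq M `` {\<lambda>\<omega>. - f \<omega>}"])
      (simp_all add: A add_L0_class class_in_carrier_L0 zero_L0)
qed (auto elim!: carrier_L0E simp: add_L0_class class_in_carrier_L0 zero_L0 ac_simps)

lemma module_L0: "module (ring_of_type_algebra :: real ring) (L0 M)"
proof (rule moduleI)
  show "cring (ring_of_type_algebra :: real ring)"
    by (rule cring_from_type_algebra)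
  show "abelian_group (L0 M)"
    by (rule abelian_group_L0)
qed (auto elim!: carrier_L0E simp: ring_of_type_algebra_def add_L0_class smult_L0_class
    class_in_carrier_L0 algebra_simps)

section \<open>The spectral norm\<close>

text \<open>
  The integrand is nonnegative, so the negative part in the definition of the spectral risk
  contributes \<open>0\<close>.
\<close>
lemma (in prob_space) spectral_norm_class_eq_integral:
  assumes \<sigma>: "spectral_function \<sigma>" and f[measurable]: "f \<in> borel_measurable M"
  shows "spectral_norm M \<sigma> (ae_eq M `` {f}) = enn2ereal (spectral_integral M \<sigma> (\<lambda>\<omega>. \<bar>f \<omega>\<bar>))"
proof -
  let ?q = "quantile M (\<lambda>\<omega>. \<bar>f \<omega>\<bar>)"
  have \<sigma>_nonneg: "0 \<le> \<sigma> u" if "u \<in> {0<..<1}" for u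
    using \<sigma> that by (simp add: spectral_function_def)
  have q_nonneg: "0 \<le> ?q u" if "u \<in> {0<..<1}" for u
    using that by (intro quantile_nonneg) auto
  have "(\<integral>\<^sup>+u\<in>{0<..<1}. ennreal (\<sigma> u * ?q u) \<partial>lborel)
      = (\<integral>\<^sup>+u. ennreal (\<sigma> u * ?q u) \<partial>unit_interval)"
    by (subst nn_integral_restrict_space) simp_all
  also have "\<dots> = spectral_integral M \<sigma> (\<lambda>\<omega>. \<bar>f \<omega>\<bar>)"
    unfolding spectral_integral_def using \<sigma>_nonneg
    by (intro nn_integral_cong) (simp add: space_restrict_space ennreal_mult')
  finally have pos: "(\<integral>\<^sup>+u\<in>{0<..<1}. ennreal (\<sigma> u * ?q u) \<partial>lborel)
      = spectral_integral M \<sigma> (\<lambda>\<omega>. \<bar>f \<omega>\<bar>)" .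
  have "(\<integral>\<^sup>+u\<in>{0<..<1}. ennreal (- (\<sigma> u * ?q u)) \<partial>lborel) = (\<integral>\<^sup>+u. 0 \<partial>(lborel :: real measure))"
    by (intro nn_integral_cong) (use \<sigma>_nonneg q_nonneg in \<open>auto simp: indicator_def ennreal_neg\<close>)
  with pos show ?thesis
    by (simp add: spectral_norm_class spectral_risk_def zero_ennreal.rep_eq)
qed

lemma (in prob_space) spectral_norm_add_le:
  assumes \<sigma>: "spectral_function \<sigma>" and "A \<in> carrier (L0 M)" "B \<in> carrier (L0 M)"
  shows "spectral_norm M \<sigma> (A \<oplus>\<^bsub>L0 M\<^esub> B) \<le> spectral_norm M \<sigma> A + spectral_norm M \<sigma> B"
proof -
  obtain f where f[measurable]: "f \<in> borel_measurable M" and A: "A = ae_eq M `` {f}"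
    using assms(2) by (rule carrier_L0E)
  obtain g where g[measurable]: "g \<in> borel_measurable M" and B: "B = ae_eq M `` {g}"
    using assms(3) by (rule carrier_L0E)
  have "spectral_integral M \<sigma> (\<lambda>\<omega>. \<bar>f \<omega> + g \<omega>\<bar>)
      \<le> spectral_integral M \<sigma> (\<lambda>\<omega>. \<bar>f \<omega>\<bar>) + spectral_integral M \<sigma> (\<lambda>\<omega>. \<bar>g \<omega>\<bar>)"
    by (rule spectral_integral_subadditive[OF \<sigma>]) (auto simp: abs_triangle_ineq)
  then show ?thesis
    by (simp add: A B add_L0_class spectral_norm_class_eq_integral[OF \<sigma>]
        less_eq_ennreal.rep_eq plus_ennreal.rep_eq)
qed

lemma (in prob_space) spectral_norm_smult:
  assumes \<sigma>: "spectral_function \<sigma>" and "A \<in> carrier (L0 M)"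
  shows "spectral_norm M \<sigma> (a \<odot>\<^bsub>L0 M\<^esub> A) = ereal \<bar>a\<bar> * spectral_norm M \<sigma> A"
proof -
  obtain f where f[measurable]: "f \<in> borel_measurable M" and A: "A = ae_eq M `` {f}"
    using assms(2) by (rule carrier_L0E)
  have "spectral_integral M \<sigma> (\<lambda>\<omega>. \<bar>a * f \<omega>\<bar>)
      = ennreal \<bar>a\<bar> * spectral_integral M \<sigma> (\<lambda>\<omega>. \<bar>f \<omega>\<bar>)"
    using spectral_integral_cmult[OF \<sigma>, of "\<lambda>\<omega>. \<bar>f \<omega>\<bar>" "\<bar>a\<bar>"] by (simp add: abs_mult)
  then show ?thesis
    by (simp add: A smult_L0_class spectral_norm_class_eq_integral[OF \<sigma>]
        times_ennreal.rep_eq enn2ereal_ennreal)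
qed

lemma (in prob_space) spectral_norm_eq_0_iff:
  assumes \<sigma>: "spectral_function \<sigma>" and A_in: "A \<in> carrier (L0 M)"
  shows "spectral_norm M \<sigma> A = 0 \<longleftrightarrow> A = \<zero>\<^bsub>L0 M\<^esub>"
proof
  assume "A = \<zero>\<^bsub>L0 M\<^esub>"
  then have "0 \<odot>\<^bsub>L0 M\<^esub> A = A"
    by (simp add: zero_L0 smult_L0_class)
  moreover have "spectral_norm M \<sigma> (0 \<odot>\<^bsub>L0 M\<^esub> A) = 0"
    using spectral_norm_smult[OF \<sigma> A_in, of 0] by (simp flip: zero_ereal_def)
  ultimately show "spectral_norm M \<sigma> A = 0"
    by simp
next
  assume zero: "spectral_norm M \<sigma> A = 0"
  obtain f where f[measurable]: "f \<in> borel_measurable M" and A: "A = ae_eq M `` {f}"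
    using A_in by (rule carrier_L0E)
  have "enn2ereal (spectral_integral M \<sigma> (\<lambda>\<omega>. \<bar>f \<omega>\<bar>)) = enn2ereal 0"
    using zero by (simp add: A spectral_norm_class_eq_integral[OF \<sigma>] zero_ennreal.rep_eq)
  then have "spectral_integral M \<sigma> (\<lambda>\<omega>. \<bar>f \<omega>\<bar>) = 0"
    by (simp only: enn2ereal_inject)
  then have "AE \<omega> in M. \<bar>f \<omega>\<bar> = 0"
    by (intro spectral_integral_eq_0_imp_AE[OF \<sigma>]) auto
  then show "A = \<zero>\<^bsub>L0 M\<^esub>"
    by (simp add: A class_eq_zero_iff)
qed

lemma (in prob_space) module_L_spectral:
  assumes \<sigma>: "spectral_function \<sigma>"
  shows "module (ring_of_type_algebra :: real ring) (L_spectral M \<sigma>)"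
proof -
  let ?R = "ring_of_type_algebra :: real ring"
  let ?H = "{A \<in> carrier (L0 M). spectral_norm M \<sigma> A < \<infinity>}"
  interpret L0: module ?R "L0 M"
    by (rule module_L0)
  have R: "a \<in> carrier ?R" for a
    by (simp add: ring_of_type_algebra_def)
  have smult: "a \<odot>\<^bsub>L0 M\<^esub> A \<in> ?H" if A: "A \<in> ?H" for a A
  proof -
    have "\<bar>spectral_norm M \<sigma> A\<bar> \<noteq> \<infinity>"
      using A spectral_norm_nonneg[OF prob_space_axioms \<sigma>, of A] by auto
    then show ?thesis
      using A R[of a] by (auto simp: spectral_norm_smult[OF \<sigma>])
  qed
  have "submodule ?H ?R (L0 M)"
  proof (rule L0.submoduleI)
    show "\<zero>\<^bsub>L0 M\<^esub> \<in> ?H"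
      using spectral_norm_eq_0_iff[OF \<sigma> L0.M.zero_closed] by simp
    fix A assume A: "A \<in> ?H"
    \<comment> \<open>Negation is scalar multiplication by \<open>-1\<close>, which is already known to stay in \<open>?H\<close>.\<close>
    then have "\<ominus>\<^bsub>L0 M\<^esub> A = (\<ominus>\<^bsub>?R\<^esub> \<one>\<^bsub>?R\<^esub>) \<odot>\<^bsub>L0 M\<^esub> A"
      by (simp add: L0.smult_l_minus R)
    then show "\<ominus>\<^bsub>L0 M\<^esub> A \<in> ?H"
      using smult[OF A] by simp
  next
    fix A B assume AB: "A \<in> ?H" "B \<in> ?H"
    then have "spectral_norm M \<sigma> (A \<oplus>\<^bsub>L0 M\<^esub> B) \<le> spectral_norm M \<sigma> A + spectral_norm M \<sigma> B"
      by (intro spectral_norm_add_le[OF \<sigma>]) auto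
    also have "\<dots> < \<infinity>"
      using AB by (cases "spectral_norm M \<sigma> A"; cases "spectral_norm M \<sigma> B") auto
    finally show "A \<oplus>\<^bsub>L0 M\<^esub> B \<in> ?H"
      using AB by simp
  qed (use smult in auto)
  then show ?thesis
    unfolding L_spectral_def by (rule submodule.submodule_is_module) (rule module_L0)
qed

theorem proposition10:
  fixes M :: "'a measure" and \<sigma> :: "real \<Rightarrow> real"
  assumes "prob_space M" and "spectral_function \<sigma>"
  shows "is_norm_on (L_spectral M \<sigma>) (\<lambda>A. real_of_ereal (spectral_norm M \<sigma> A))"
proof -
  interpret prob_space M by fact
  note \<sigma> = assms(2)
  let ?H = "carrier (L_spectral M \<sigma>)"
  have carrier_L0: "A \<in> carrier (L0 M)" if "A \<in> ?H" for A
    using that by (simp add: L_spectral_def)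
  have finite_norm: "\<exists>r\<ge>0. spectral_norm M \<sigma> A = ereal r" if A: "A \<in> ?H" for A
    using A spectral_norm_nonneg[OF assms carrier_L0[OF A]]
    by (cases "spectral_norm M \<sigma> A") (auto simp: L_spectral_def)
  have ops: "\<zero>\<^bsub>L_spectral M \<sigma>\<^esub> = \<zero>\<^bsub>L0 M\<^esub>"
    "a \<odot>\<^bsub>L_spectral M \<sigma>\<^esub> A = a \<odot>\<^bsub>L0 M\<^esub> A"
    "A \<oplus>\<^bsub>L_spectral M \<sigma>\<^esub> B = A \<oplus>\<^bsub>L0 M\<^esub> B" for a A B
    by (simp_all add: L_spectral_def)
  interpret L: module "ring_of_type_algebra :: real ring" "L_spectral M \<sigma>"
    by (rule module_L_spectral[OF \<sigma>])
  show ?thesis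
    unfolding is_norm_on_def
  proof (intro conjI ballI allI)
    show "module (ring_of_type_algebra :: real ring) (L_spectral M \<sigma>)"
      by (rule module_L_spectral[OF \<sigma>])
  next
    fix A assume A: "A \<in> ?H"
    obtain r where r: "0 \<le> r" "spectral_norm M \<sigma> A = ereal r"
      using finite_norm[OF A] by blast
    then show "0 \<le> real_of_ereal (spectral_norm M \<sigma> A)"
      by simp
    show "real_of_ereal (spectral_norm M \<sigma> A) = 0 \<longleftrightarrow> A = \<zero>\<^bsub>L_spectral M \<sigma>\<^esub>"
      using r spectral_norm_eq_0_iff[OF \<sigma> carrier_L0[OF A]] by (simp add: ops)
    show "real_of_ereal (spectral_norm M \<sigma> (a \<odot>\<^bsub>L_spectral M \<sigma>\<^esub> A))
        = \<bar>a\<bar> * real_of_ereal (spectral_norm M \<sigma> A)" for a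
      using r by (simp add: ops spectral_norm_smult[OF \<sigma> carrier_L0[OF A]])
    fix B assume B: "B \<in> ?H"
    have "A \<oplus>\<^bsub>L_spectral M \<sigma>\<^esub> B \<in> ?H"
      using A B by (rule L.M.a_closed)
    from finite_norm[OF this] finite_norm[OF B] r
    show "real_of_ereal (spectral_norm M \<sigma> (A \<oplus>\<^bsub>L_spectral M \<sigma>\<^esub> B))
        \<le> real_of_ereal (spectral_norm M \<sigma> A) + real_of_ereal (spectral_norm M \<sigma> B)"
      using spectral_norm_add_le[OF \<sigma> carrier_L0[OF A] carrier_L0[OF B]] by (auto simp: ops)
  qed
qed

end
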